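(* Let $\mathcal{C}$ be a clutter and let $I_c(\mathcal{C})$ be its ideal of covers. If $I_c(\mathcal{C})$ is normal, then $I_c(\mathcal{H})$ is normal for any minor $\mathcal{H}$ of $\mathcal{C}$.
   Context: A clutter $\mathcal{C}$ with finite vertex set $V(\mathcal{C})=\{t_1,\ldots,t_s\}$ is a family $E(\mathcal{C})$ of subsets of $V(\mathcal{C})$, called edges, none of which is contained in another. The vertices are regarded as variables of the polynomial ring $S=K[t_1,\ldots,t_s]$ over a field $K$. A vertex cover of $\mathcal{C}$ is a set of vertices meeting every edge of $\mathcal{C}$; it is minimal if it is minimal with respect to inclusion. The ideal of covers $I_c(\mathcal{C})$ is the ideal of $S$ generated by all squarefree monomials $\prod_{t_i\in C}t_i$ with $C$ a minimal vertex cover of $\mathcal{C}$ (so $I_c(\mathcal{C})=S$ if $\mathcal{C}$ has no edges). For a vertex $t_i$, the contraction $\mathcal{C}/t_i$ and the deletion $\mathcal{C}\setminus t_i$ are the clutters with vertex set $V(\mathcal{C})\setminus\{t_i\}$ such that $E(\mathcal{C}/t_i)$ is the set of inclusion-minimal elements of $\{e\setminus\{t_i\}\mid e\in E(\mathcal{C})\}$ and $E(\mathcal{C}\setminus t_i)=\{e\mid t_i\notin e\in E(\mathcal{C})\}$. A minor of $\mathcal{C}$ is a clutter obtained from $\mathcal{C}$ by a sequence of deletions and contractions in any order. An ideal $J$ is normal if $J^n=\overline{J^n}$ for all $n\geq 1$, where $\overline{J^n}$ is the integral closure of $J^n$. *)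

theory Defs
  imports "HOL-Algebra.Algebra" "HOL-Library.Poly_Mapping"
begin

section \<open>Clutters and their minors\<close>

record 'v set_system =
  verts :: "'v set"
  edges :: "'v set set"

definition clutter :: "'v set_system \<Rightarrow> bool" where
  "clutter C \<longleftrightarrow> finite (verts C) \<and> (\<forall>e\<in>edges C. e \<subseteq> verts C) \<and>
     (\<forall>e\<in>edges C. \<forall>f\<in>edges C. e \<subseteq> f \<longrightarrow> e = f)"

definition minimal_sets :: "'v set set \<Rightarrow> 'v set set" where
  "minimal_sets F = {A \<in> F. \<forall>B\<in>F. B \<subseteq> A \<longrightarrow> B = A}"

definition vertex_cover :: "'v set_system \<Rightarrow> 'v set \<Rightarrow> bool" where
  "vertex_cover C A \<longleftrightarrow> A \<subseteq> verts C \<and> (\<forall>e\<in>edges C. A \<inter> e \<noteq> {})"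

definition min_vertex_covers :: "'v set_system \<Rightarrow> 'v set set" where
  "min_vertex_covers C = minimal_sets {A. vertex_cover C A}"

definition contraction :: "'v set_system \<Rightarrow> 'v \<Rightarrow> 'v set_system" where
  "contraction C t = \<lparr>verts = verts C - {t}, edges = minimal_sets ((\<lambda>e. e - {t}) ` edges C)\<rparr>"

definition deletion :: "'v set_system \<Rightarrow> 'v \<Rightarrow> 'v set_system" where
  "deletion C t = \<lparr>verts = verts C - {t}, edges = {e \<in> edges C. t \<notin> e}\<rparr>"

text \<open>\<open>minor H C\<close>: \<open>H\<close> is a minor of \<open>C\<close>; the empty sequence of operations is allowed.\<close>

inductive minor :: "'v set_system \<Rightarrow> 'v set_system \<Rightarrow> bool" where
  minor_refl: "minor C C"
| minor_deletion: "minor H C \<Longrightarrow> t \<in> verts H \<Longrightarrow> minor (deletion H t) C"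
| minor_contraction: "minor H C \<Longrightarrow> t \<in> verts H \<Longrightarrow> minor (contraction H t) C"

lemma clutter_deletion: "clutter C \<Longrightarrow> clutter (deletion C t)"
  by (auto simp: clutter_def deletion_def)

lemma clutter_contraction: "clutter C \<Longrightarrow> clutter (contraction C t)"
  by (auto simp: clutter_def contraction_def minimal_sets_def)

lemma clutter_minor: "minor H C \<Longrightarrow> clutter C \<Longrightarrow> clutter H"
  by (induction rule: minor.induct) (auto intro: clutter_deletion clutter_contraction)


section \<open>Polynomial rings\<close>

text \<open>
  Monomials are exponent vectors \<open>'v \<Rightarrow>\<^sub>0 nat\<close>, and a polynomial is a finitely supported
  function from monomials to coefficients, so \<open>keys p\<close> is the set of monomials occurring in
  \<open>p\<close> and \<open>keys m\<close> the set of variables occurring in \<open>m\<close>. The ring \<open>mpoly_ring TYPE('k) V\<close> is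
  the polynomial ring over the field \<open>'k\<close> in the variables \<open>V\<close> only: a clutter and its
  proper minors have ideals of covers in different rings.
\<close>

definition mpoly_ring ::
  "'k::field itself \<Rightarrow> 'v set \<Rightarrow> (('v \<Rightarrow>\<^sub>0 nat) \<Rightarrow>\<^sub>0 'k) ring" where
  "mpoly_ring _ V = \<lparr>carrier = {p. \<forall>m\<in>Poly_Mapping.keys p. Poly_Mapping.keys m \<subseteq> V},
     monoid.mult = (*), one = 1, ring.zero = 0, add = (+)\<rparr>"

lemma cring_mpoly_ring: "cring (mpoly_ring TYPE('k::field) V)"
proof (rule cringI)
  show "abelian_group (mpoly_ring TYPE('k) V)"
  proof (rule abelian_groupI)
    fix p assume "p \<in> carrier (mpoly_ring TYPE('k) V)"
    then show "\<exists>q\<in>carrier (mpoly_ring TYPE('k) V).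
        q \<oplus>\<^bsub>mpoly_ring TYPE('k) V\<^esub> p = \<zero>\<^bsub>mpoly_ring TYPE('k) V\<^esub>"
      by (intro bexI[of _ "- p"]) (auto simp: mpoly_ring_def)
  qed (use keys_add in \<open>fastforce simp: mpoly_ring_def algebra_simps\<close>)+
  show "comm_monoid (mpoly_ring TYPE('k) V)"
  proof (rule comm_monoidI)
    fix p q assume pq: "p \<in> carrier (mpoly_ring TYPE('k) V)" "q \<in> carrier (mpoly_ring TYPE('k) V)"
    have "Poly_Mapping.keys m \<subseteq> V" if m: "m \<in> Poly_Mapping.keys (p * q)" for m
    proof -
      obtain a b where "a \<in> Poly_Mapping.keys p" "b \<in> Poly_Mapping.keys q" "m = a + b"
        using m keys_mult[of p q] by blast
      with pq show ?thesis
        using Poly_Mapping.keys_add[of a b] by (fastforce simp: mpoly_ring_def)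
    qed
    then show "p \<otimes>\<^bsub>mpoly_ring TYPE('k) V\<^esub> q \<in> carrier (mpoly_ring TYPE('k) V)"
      by (simp add: mpoly_ring_def)
  qed (auto simp: mpoly_ring_def algebra_simps)
qed (auto simp: mpoly_ring_def algebra_simps)


section \<open>Normal ideals\<close>

text \<open>The power \<open>J\<^sup>n\<close> of an ideal is taken in the semiring of ideals; in particular
  \<open>J\<^sup>0\<close> is the whole ring.\<close>

abbreviation ideal_pow :: "('a, 'b) ring_scheme \<Rightarrow> 'a set \<Rightarrow> nat \<Rightarrow> 'a set" where
  "ideal_pow R J n \<equiv> J [^]\<^bsub>ideals_set R\<^esub> n"

text \<open>
  The elements \<open>f\<close> satisfying an equation
  \<open>f\<^sup>k + a\<^sub>1 f\<^sup>k\<^sup>-\<^sup>1 + \<dots> + a\<^sub>k = 0\<close> with \<open>k \<ge> 1\<close> and \<open>a\<^sub>i \<in> J\<^sup>i\<close>.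
\<close>

definition integral_closure :: "('a, 'b) ring_scheme \<Rightarrow> 'a set \<Rightarrow> 'a set" where
  "integral_closure R J = {f \<in> carrier R. \<exists>(k::nat) a. k \<ge> 1 \<and>
     (\<forall>i\<in>{1..k}. a i \<in> ideal_pow R J i) \<and>
     f [^]\<^bsub>R\<^esub> k \<oplus>\<^bsub>R\<^esub> (\<Oplus>\<^bsub>R\<^esub>i\<in>{1..k}. a i \<otimes>\<^bsub>R\<^esub> f [^]\<^bsub>R\<^esub> (k - i)) = \<zero>\<^bsub>R\<^esub>}"

definition normal_ideal :: "('a, 'b) ring_scheme \<Rightarrow> 'a set \<Rightarrow> bool" where
  "normal_ideal R J \<longleftrightarrow> ideal J R \<and>
     (\<forall>n::nat. n \<ge> 1 \<longrightarrow> ideal_pow R J n = integral_closure R (ideal_pow R J n))"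


section \<open>The ideal of covers\<close>

definition squarefree_monom :: "'v set \<Rightarrow> ('v \<Rightarrow>\<^sub>0 nat) \<Rightarrow>\<^sub>0 'k::field" where
  "squarefree_monom A = (\<Prod>t\<in>A. Poly_Mapping.single (Poly_Mapping.single t 1) 1)"

definition cover_ideal ::
  "'k::field itself \<Rightarrow> 'v set_system \<Rightarrow> (('v \<Rightarrow>\<^sub>0 nat) \<Rightarrow>\<^sub>0 'k) set" where
  "cover_ideal K C = Idl\<^bsub>mpoly_ring K (verts C)\<^esub> (squarefree_monom ` min_vertex_covers C)"

lemma squarefree_monom_eq_single:
  "squarefree_monom A = Poly_Mapping.single (\<Sum>t\<in>A. Poly_Mapping.single t 1) 1"
  unfolding squarefree_monom_def
  by (induction A rule: infinite_finite_induct) (simp_all add: mult_single)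

lemma squarefree_monom_closed:
  assumes "A \<subseteq> V"
  shows "squarefree_monom A \<in> carrier (mpoly_ring TYPE('k::field) V)"
  using assms Poly_Mapping.keys_sum[of "\<lambda>t. Poly_Mapping.single t (1::nat)" A]
  by (auto simp: squarefree_monom_eq_single mpoly_ring_def)

lemma ideal_cover_ideal:
  "ideal (cover_ideal TYPE('k::field) C) (mpoly_ring TYPE('k) (verts C))"
proof -
  interpret cring "mpoly_ring TYPE('k) (verts C)" by (rule cring_mpoly_ring)
  show ?thesis
    unfolding cover_ideal_def
    by (rule genideal_ideal)
      (auto simp: min_vertex_covers_def minimal_sets_def vertex_cover_def
        intro!: squarefree_monom_closed)
qed

end

theory Submission
  imports Defs
begin

text \<open>
  By induction on the sequence of operations it suffices to treat one contraction and one
  deletion at a vertex \<open>t\<close>. Write \<open>I\<close> for the ideal of covers of \<open>\<C>\<close> in \<open>S = K[V]\<close>, and \<open>J\<close> for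
  that of the smaller clutter in \<open>R = K[V - {t}]\<close>. The covers of \<open>\<C> / t\<close> are the covers of \<open>\<C>\<close> that
  avoid \<open>t\<close>, so \<open>J\<close> is the image of \<open>I\<close> under \<open>t \<mapsto> 0\<close>, and \<open>J \<subseteq> I\<close>. A set \<open>A\<close> avoiding \<open>t\<close> covers the
  deletion \<open>\<C> - t\<close> iff \<open>A \<union> {t}\<close> covers \<open>\<C>\<close>, so there \<open>J\<close> is the image of \<open>I\<close> under \<open>t \<mapsto> 1\<close>, and
  \<open>t J \<subseteq> I\<close>.

  Both cases are thus instances of one situation: a retraction \<open>e : S \<rightarrow> R\<close> of the inclusion
  \<open>R \<subseteq> S\<close> with \<open>e(I) \<subseteq> J\<close>, and an element \<open>u\<close> of \<open>S\<close> with \<open>e(u) = 1\<close> and \<open>u J \<subseteq> I\<close>, where \<open>u = 1\<close> for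
  the contraction and \<open>u = t\<close> for the deletion. In this situation normality passes from \<open>I\<close> to \<open>J\<close>
  (\<open>normal_ideal_retract\<close>): if \<open>f\<close> is integral over \<open>J\<^sup>n\<close>, then, as \<open>u\<^sup>n J\<^sup>n \<subseteq> I\<^sup>n\<close>, scaling an
  equation of integral dependence shows that \<open>u\<^sup>n f\<close> is integral over \<open>I\<^sup>n\<close>
  (\<open>semilinear_integral_closure\<close>). Hence \<open>u\<^sup>n f \<in> I\<^sup>n\<close>, and applying \<open>e\<close> gives \<open>f \<in> J\<^sup>n\<close>.
\<close>

section \<open>Normality under retractions\<close>

lemma one_ideals_set [simp]: "\<one>\<^bsub>ideals_set R\<^esub> = carrier R"
  by (simp add: ideals_set_def)

lemma mult_ideals_set [simp]: "I \<otimes>\<^bsub>ideals_set R\<^esub> J = I \<cdot>\<^bsub>R\<^esub> J"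
  by (simp add: ideals_set_def)

lemma (in cring) ideal_ideal_pow: "ideal I R \<Longrightarrow> ideal (ideal_pow R I (n::nat)) R"
  by (induction n) (simp_all add: oneideal ideal_prod_is_ideal)

lemma (in cring) ideal_pow_1: "ideal I R \<Longrightarrow> ideal_pow R I (Suc 0) = I"
  by (simp add: ideal_prod_commute[OF oneideal] ideal_prod_one)

text \<open>An element \<open>f\<close> of \<open>I\<close> satisfies the equation \<open>X - f = 0\<close> of degree 1.\<close>

lemma (in cring) subset_integral_closure:
  assumes I: "ideal I R"
  shows "I \<subseteq> integral_closure R I"
proof
  fix f assume f: "f \<in> I"
  then have fR: "f \<in> carrier R" using I ideal.Icarr by fastforce
  have "\<ominus> f \<in> I"
    using I f by (simp add: additive_subgroup.a_inv_closed ideal.axioms(1))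
  then have "\<forall>i\<in>{1..1}. (\<lambda>_. \<ominus> f) i \<in> ideal_pow R I i"
    using ideal_pow_1[OF I] by simp
  moreover have "f [^] (1::nat) \<oplus> (\<Oplus>i\<in>{1..1::nat}. \<ominus> f \<otimes> f [^] (1 - i)) = \<zero>"
    using fR by (simp add: r_neg)
  ultimately show "f \<in> integral_closure R I"
    unfolding integral_closure_def using fR by fastforce
qed

text \<open>
  The maps to transport ideals along are \<open>x \<mapsto> u h(x)\<close> rather than plain ring homomorphisms: this
  covers the inclusion twisted by the deleted variable, and with \<open>u = 1\<close> also the evaluations.
  On the \<open>n\<close>-th power of an ideal the twist becomes \<open>u\<^sup>n\<close>, one factor for each factor of a product.
\<close>

lemma (in ring_hom_cring) semilinear_ideal_pow:
  assumes u: "u \<in> carrier S" and J: "ideal J R" and I: "ideal I S"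
    and uJ: "\<And>x. x \<in> J \<Longrightarrow> u \<otimes>\<^bsub>S\<^esub> h x \<in> I"
    and x: "x \<in> ideal_pow R J (n::nat)"
  shows "u [^]\<^bsub>S\<^esub> n \<otimes>\<^bsub>S\<^esub> h x \<in> ideal_pow S I n"
  using x
proof (induction n arbitrary: x)
  case 0
  then show ?case using u by simp
next
  case (Suc n)
  from Suc.prems have "x \<in> ideal_pow R J n \<cdot> J" by simp
  \<comment> \<open>Membership in the carrier is carried along because \<open>h\<close> is additive only there.\<close>
  then have "x \<in> carrier R \<and> u [^]\<^bsub>S\<^esub> Suc n \<otimes>\<^bsub>S\<^esub> h x \<in> ideal_pow S I n \<cdot>\<^bsub>S\<^esub> I"
  proof (induction rule: ideal_prod.induct)
    case (prod a b)
    have ab: "a \<in> carrier R" "b \<in> carrier R"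
      using prod J R.ideal_ideal_pow[OF J, of n] ideal.Icarr by metis+
    have "u [^]\<^bsub>S\<^esub> Suc n \<otimes>\<^bsub>S\<^esub> h (a \<otimes> b)
        = (u [^]\<^bsub>S\<^esub> n \<otimes>\<^bsub>S\<^esub> h a) \<otimes>\<^bsub>S\<^esub> (u \<otimes>\<^bsub>S\<^esub> h b)"
      using ab u by (simp add: S.m_ac)
    then show ?case
      using ideal_prod.prod[OF Suc.IH[OF prod(1)] uJ[OF prod(2)]] ab by simp
  next
    case (sum a b)
    then show ?case
      using ideal_prod.sum[of _ S] u by (simp add: S.r_distr del: S.nat_pow_Suc)
  qed
  then show ?case by simp
qed

text \<open>
  Multiplying \<open>f\<^sup>k + a\<^sub>1 f\<^sup>k\<^sup>-\<^sup>1 + \<dots> + a\<^sub>k = 0\<close> by \<open>u\<^sup>k\<close> gives an equation for \<open>u f\<close> with coefficients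
  \<open>u\<^sup>i a\<^sub>i\<close>, and these lie in \<open>I\<^sup>i\<close> by the previous lemma.
\<close>

lemma (in ring_hom_cring) semilinear_integral_closure:
  assumes u: "u \<in> carrier S" and J: "ideal J R" and I: "ideal I S"
    and uJ: "\<And>x. x \<in> J \<Longrightarrow> u \<otimes>\<^bsub>S\<^esub> h x \<in> I"
    and f: "f \<in> integral_closure R J"
  shows "u \<otimes>\<^bsub>S\<^esub> h f \<in> integral_closure S I"
proof -
  from f obtain k a where fR: "f \<in> carrier R" and k: "k \<ge> (1::nat)"
    and a: "\<forall>i\<in>{1..k}. a i \<in> ideal_pow R J i"
    and eq: "f [^] k \<oplus> (\<Oplus>i\<in>{1..k}. a i \<otimes> f [^] (k - i)) = \<zero>"
    unfolding integral_closure_def by blast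
  have aR: "a i \<in> carrier R" if "i \<in> {1..k}" for i
    using a that R.ideal_ideal_pow[OF J, of i] ideal.Icarr by metis
  define b where "b i = u [^]\<^bsub>S\<^esub> i \<otimes>\<^bsub>S\<^esub> h (a i)" for i :: nat
  have b: "b i \<in> ideal_pow S I i" if "i \<in> {1..k}" for i
    unfolding b_def using semilinear_ideal_pow[OF u J I uJ] a that by blast
  have bS: "b i \<in> carrier S" if "i \<in> {1..k}" for i
    using aR[OF that] u by (simp add: b_def)
  have term_eq: "u [^]\<^bsub>S\<^esub> k \<otimes>\<^bsub>S\<^esub> h (a i \<otimes> f [^] (k - i))
      = b i \<otimes>\<^bsub>S\<^esub> (u \<otimes>\<^bsub>S\<^esub> h f) [^]\<^bsub>S\<^esub> (k - i)" if i: "i \<in> {1..k}" for i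
  proof -
    have "u [^]\<^bsub>S\<^esub> k = u [^]\<^bsub>S\<^esub> i \<otimes>\<^bsub>S\<^esub> u [^]\<^bsub>S\<^esub> (k - i)"
      using i u by (simp add: S.nat_pow_mult)
    then show ?thesis
      using i u fR aR[OF i] by (simp add: b_def S.nat_pow_distrib S.m_ac)
  qed
  have "\<zero>\<^bsub>S\<^esub> = u [^]\<^bsub>S\<^esub> k \<otimes>\<^bsub>S\<^esub> h (f [^] k \<oplus> (\<Oplus>i\<in>{1..k}. a i \<otimes> f [^] (k - i)))"
    unfolding eq using u by simp
  also have "\<dots> = u [^]\<^bsub>S\<^esub> k \<otimes>\<^bsub>S\<^esub> h f [^]\<^bsub>S\<^esub> k
      \<oplus>\<^bsub>S\<^esub> u [^]\<^bsub>S\<^esub> k \<otimes>\<^bsub>S\<^esub> (\<Oplus>\<^bsub>S\<^esub>i\<in>{1..k}. h (a i \<otimes> f [^] (k - i)))"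
  proof -
    have "(\<lambda>i. a i \<otimes> f [^] (k - i)) \<in> {1..k} \<rightarrow> carrier R"
      using fR aR by auto
    then show ?thesis
      using fR u by (simp add: hom_finsum S.r_distr R.finsum_closed S.finsum_closed comp_def Pi_iff del: hom_mult)
  qed
  also have "u [^]\<^bsub>S\<^esub> k \<otimes>\<^bsub>S\<^esub> (\<Oplus>\<^bsub>S\<^esub>i\<in>{1..k}. h (a i \<otimes> f [^] (k - i)))
      = (\<Oplus>\<^bsub>S\<^esub>i\<in>{1..k}. u [^]\<^bsub>S\<^esub> k \<otimes>\<^bsub>S\<^esub> h (a i \<otimes> f [^] (k - i)))"
    using fR aR u by (intro S.finsum_rdistr) (auto simp del: hom_mult)
  also have "\<dots> = (\<Oplus>\<^bsub>S\<^esub>i\<in>{1..k}. b i \<otimes>\<^bsub>S\<^esub> (u \<otimes>\<^bsub>S\<^esub> h f) [^]\<^bsub>S\<^esub> (k - i))"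
    using bS fR u by (intro S.finsum_cong' term_eq) auto
  also have "u [^]\<^bsub>S\<^esub> k \<otimes>\<^bsub>S\<^esub> h f [^]\<^bsub>S\<^esub> k = (u \<otimes>\<^bsub>S\<^esub> h f) [^]\<^bsub>S\<^esub> k"
    using fR u by (simp add: S.nat_pow_distrib)
  finally have "(u \<otimes>\<^bsub>S\<^esub> h f) [^]\<^bsub>S\<^esub> k
      \<oplus>\<^bsub>S\<^esub> (\<Oplus>\<^bsub>S\<^esub>i\<in>{1..k}. b i \<otimes>\<^bsub>S\<^esub> (u \<otimes>\<^bsub>S\<^esub> h f) [^]\<^bsub>S\<^esub> (k - i)) = \<zero>\<^bsub>S\<^esub>"
    by simp
  then show ?thesis
    unfolding integral_closure_def using k b fR u by (auto intro!: exI[of _ k] exI[of _ b])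
qed

text \<open>
  If \<open>f\<close> is integral over \<open>J\<^sup>n\<close>, then \<open>u\<^sup>n h(f)\<close> is integral over \<open>I\<^sup>n\<close>, by semilinear transport with
  twist \<open>u\<^sup>n\<close> between the ideals \<open>J\<^sup>n\<close> and \<open>I\<^sup>n\<close>. It then lies in \<open>I\<^sup>n\<close>, and \<open>e\<close> takes it to \<open>f\<close>.
\<close>

lemma normal_ideal_retract:
  assumes h: "ring_hom_cring R S h" and e: "ring_hom_cring S R e"
    and eh: "\<And>x. x \<in> carrier R \<Longrightarrow> e (h x) = x"
    and u: "u \<in> carrier S" "e u = \<one>\<^bsub>R\<^esub>"
    and J: "ideal J R"
    and uJ: "\<And>x. x \<in> J \<Longrightarrow> u \<otimes>\<^bsub>S\<^esub> h x \<in> I"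
    and eI: "\<And>x. x \<in> I \<Longrightarrow> e x \<in> J"
    and normal: "normal_ideal S I"
  shows "normal_ideal R J"
proof -
  interpret h: ring_hom_cring R S h by (rule h)
  interpret e: ring_hom_cring S R e by (rule e)
  have I: "ideal I S" using normal by (simp add: normal_ideal_def)
  have "integral_closure R (ideal_pow R J n) \<subseteq> ideal_pow R J n" if n: "n \<ge> 1" for n :: nat
  proof
    fix f assume f: "f \<in> integral_closure R (ideal_pow R J n)"
    then have fR: "f \<in> carrier R" by (simp add: integral_closure_def)
    have "u [^]\<^bsub>S\<^esub> n \<otimes>\<^bsub>S\<^esub> h f \<in> integral_closure S (ideal_pow S I n)"
      using f u h.semilinear_ideal_pow[OF u(1) J I uJ]
      by (intro h.semilinear_integral_closure[OF _ h.R.ideal_ideal_pow[OF J]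
            h.S.ideal_ideal_pow[OF I]]) auto
    then have "u [^]\<^bsub>S\<^esub> n \<otimes>\<^bsub>S\<^esub> h f \<in> ideal_pow S I n"
      using normal n by (simp add: normal_ideal_def)
    \<comment> \<open>The map \<open>e\<close> sends \<open>I\<^sup>n\<close> into \<open>J\<^sup>n\<close>: this is the semilinear statement with twist 1.\<close>
    then have "\<one>\<^bsub>R\<^esub> [^]\<^bsub>R\<^esub> n \<otimes>\<^bsub>R\<^esub> e (u [^]\<^bsub>S\<^esub> n \<otimes>\<^bsub>S\<^esub> h f) \<in> ideal_pow R J n"
      using eI ideal.Icarr[OF I] by (intro e.semilinear_ideal_pow[OF _ I J]) auto
    then show "f \<in> ideal_pow R J n"
      using fR u by (simp add: eh)
  qed
  then show ?thesis
    using J h.R.subset_integral_closure[OF h.R.ideal_ideal_pow[OF J]]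
    by (auto simp: normal_ideal_def)
qed

section \<open>Evaluating one variable\<close>

text \<open>
  Evaluation keeps the type of exponent vectors and sets the exponent of \<open>t\<close> to zero, because the
  polynomial rings in fewer variables are subsets of one common type.
\<close>

definition eval_var ::
  "'v \<Rightarrow> 'k \<Rightarrow> (('v \<Rightarrow>\<^sub>0 nat) \<Rightarrow>\<^sub>0 'k::field) \<Rightarrow> (('v \<Rightarrow>\<^sub>0 nat) \<Rightarrow>\<^sub>0 'k)" where
  "eval_var t c p = (\<Sum>m\<in>Poly_Mapping.keys p.
     Poly_Mapping.single (Poly_Mapping.update t 0 m)
       (Poly_Mapping.lookup p m * c ^ Poly_Mapping.lookup m t))"

lemma eval_var_eq_sum:
  assumes "finite A" "Poly_Mapping.keys p \<subseteq> A"
  shows "eval_var t c p = (\<Sum>m\<in>A. Poly_Mapping.single (Poly_Mapping.update t 0 m)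
       (Poly_Mapping.lookup p m * c ^ Poly_Mapping.lookup m t))"
  unfolding eval_var_def using assms
  by (intro sum.mono_neutral_left) (auto simp: in_keys_iff)

lemma eval_var_add: "eval_var t c (p + q) = eval_var t c p + eval_var t c q"
  using keys_add[of p q]
  by (simp add: eval_var_eq_sum[of "Poly_Mapping.keys p \<union> Poly_Mapping.keys q"] lookup_add
      distrib_right single_add sum.distrib)

lemma eval_var_single:
  "eval_var t c (Poly_Mapping.single m a) =
     Poly_Mapping.single (Poly_Mapping.update t 0 m) (a * c ^ Poly_Mapping.lookup m t)"
  by (subst eval_var_eq_sum[of "{m}"]) auto

lemma eval_var_0: "eval_var t c 0 = 0"
  by (simp add: eval_var_def)

lemma update_0_add:
  "Poly_Mapping.update t 0 (m + n) = Poly_Mapping.update t 0 m + Poly_Mapping.update t (0::nat) n"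
  by (rule poly_mapping_eqI) (auto simp: lookup_update lookup_add)

lemma poly_mapping_monomial_induct [case_names zero add]:
  fixes p :: "'a \<Rightarrow>\<^sub>0 'b::monoid_add"
  assumes "P 0" and "\<And>p m a. P p \<Longrightarrow> P (Poly_Mapping.single m a + p)"
  shows "P p"
proof (induction p rule: update_induct)
  case (update p m a)
  have "Poly_Mapping.update m a p = Poly_Mapping.single m a + p"
    using update(1)
    by (intro poly_mapping_eqI) (auto simp: lookup_update lookup_add lookup_single in_keys_iff)
  then show ?case using assms(2)[OF update(3)] by simp
qed (rule assms(1))

lemma eval_var_mult: "eval_var t c (p * q) = eval_var t c p * eval_var t c q"
proof (induction p rule: poly_mapping_monomial_induct)
  case zero
  then show ?case by (simp add: eval_var_0)
next
  case (add p m a)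
  have "eval_var t c (Poly_Mapping.single m a * q)
      = eval_var t c (Poly_Mapping.single m a) * eval_var t c q"
  proof (induction q rule: poly_mapping_monomial_induct)
    case zero
    then show ?case by (simp add: eval_var_0)
  next
    case (add q n b)
    then show ?case
      by (simp add: distrib_left eval_var_add mult_single eval_var_single update_0_add
          lookup_add power_add mult_ac)
  qed
  with add show ?case by (simp add: distrib_right eval_var_add)
qed

lemma eval_var_eq_self:
  assumes "\<And>m. m \<in> Poly_Mapping.keys p \<Longrightarrow> t \<notin> Poly_Mapping.keys m"
  shows "eval_var t c p = p"
proof -
  have "eval_var t c p = (\<Sum>m\<in>Poly_Mapping.keys p. Poly_Mapping.single m (Poly_Mapping.lookup p m))"
    unfolding eval_var_def
  proof (rule sum.cong[OF refl])
    fix m assume "m \<in> Poly_Mapping.keys p"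
    from assms[OF this] have "Poly_Mapping.lookup m t = 0" by (simp add: in_keys_iff)
    moreover from this have "Poly_Mapping.update t 0 m = m"
      by (intro poly_mapping_eqI) (auto simp: lookup_update)
    ultimately show "Poly_Mapping.single (Poly_Mapping.update t 0 m)
        (Poly_Mapping.lookup p m * c ^ Poly_Mapping.lookup m t)
      = Poly_Mapping.single m (Poly_Mapping.lookup p m)" by simp
  qed
  also have "\<dots> = p"
    by (rule poly_mapping_eqI) (simp add: lookup_sum lookup_single when_def in_keys_iff)
  finally show ?thesis .
qed

lemma eval_var_closed:
  assumes "p \<in> carrier (mpoly_ring TYPE('k::field) V)"
  shows "eval_var t c p \<in> carrier (mpoly_ring TYPE('k) (V - {t}))"
proof -
  have "Poly_Mapping.keys n \<subseteq> V - {t}" if n: "n \<in> Poly_Mapping.keys (eval_var t c p)" for n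
  proof -
    obtain m where "m \<in> Poly_Mapping.keys p" "n = Poly_Mapping.update t 0 m"
      using n keys_sum[of _ "Poly_Mapping.keys p"] unfolding eval_var_def
      by (fastforce split: if_splits)
    with assms show ?thesis by (auto simp: mpoly_ring_def keys_update)
  qed
  then show ?thesis by (simp add: mpoly_ring_def)
qed

lemma ring_hom_eval_var:
  "ring_hom_cring (mpoly_ring TYPE('k::field) V) (mpoly_ring TYPE('k) (V - {t})) (eval_var t c)"
proof -
  have "eval_var t c \<in> ring_hom (mpoly_ring TYPE('k) V) (mpoly_ring TYPE('k) (V - {t}))"
  proof (rule ring_hom_memI)
    show "eval_var t c \<one>\<^bsub>mpoly_ring TYPE('k) V\<^esub> = \<one>\<^bsub>mpoly_ring TYPE('k) (V - {t})\<^esub>"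
      by (auto simp: mpoly_ring_def intro!: eval_var_eq_self)
  qed (rule eval_var_closed, simp_all add: mpoly_ring_def eval_var_add eval_var_mult)
  then show ?thesis
    by (intro ring_hom_cring.intro ring_hom_cring_axioms.intro cring_mpoly_ring)
qed

lemma ring_hom_inclusion:
  assumes "W \<subseteq> V"
  shows "ring_hom_cring (mpoly_ring TYPE('k::field) W) (mpoly_ring TYPE('k) V) (\<lambda>p. p)"
proof -
  have "(\<lambda>p. p) \<in> ring_hom (mpoly_ring TYPE('k) W) (mpoly_ring TYPE('k) V)"
    using assms by (intro ring_hom_memI) (auto simp: mpoly_ring_def)
  then show ?thesis
    by (intro ring_hom_cring.intro ring_hom_cring_axioms.intro cring_mpoly_ring)
qed

section \<open>Covers of minors\<close>

lemma minimal_sets_below: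
  assumes "A \<in> F" "finite A"
  obtains B where "B \<in> minimal_sets F" "B \<subseteq> A"
proof -
  obtain B where "B \<in> {B \<in> F. B \<subseteq> A}" "\<And>C. C \<in> {B \<in> F. B \<subseteq> A} \<Longrightarrow> C \<le> B \<Longrightarrow> B = C"
    using finite_has_minimal[of "{B \<in> F. B \<subseteq> A}"] assms
      finite_subset[of "{B \<in> F. B \<subseteq> A}" "Pow A"] by auto
  then show thesis by (intro that[of B]) (auto simp: minimal_sets_def)
qed

lemma vertex_cover_deletion:
  assumes "t \<in> verts C"
  shows "vertex_cover (deletion C t) A \<longleftrightarrow> t \<notin> A \<and> vertex_cover C (insert t A)"
  using assms by (auto simp: vertex_cover_def deletion_def)

text \<open>
  Passing to the inclusion-minimal sets among the \<open>e - {t}\<close> does not change the covers, since each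
  of these finite sets contains a minimal one. When \<open>{t}\<close> is an edge, both sides are false for all
  \<open>A\<close> and the ideal of covers of the contraction is zero.
\<close>

lemma vertex_cover_contraction:
  assumes "clutter C"
  shows "vertex_cover (contraction C t) A \<longleftrightarrow> t \<notin> A \<and> vertex_cover C A"
proof
  assume A: "vertex_cover (contraction C t) A"
  have "A \<inter> e \<noteq> {}" if e: "e \<in> edges C" for e
  proof -
    have "finite (e - {t})" using assms e finite_subset by (auto simp: clutter_def)
    then obtain f where "f \<in> edges (contraction C t)" "f \<subseteq> e - {t}"
      using e minimal_sets_below[of "e - {t}" "(\<lambda>e. e - {t}) ` edges C"]
      by (auto simp: contraction_def)
    with A show ?thesis by (fastforce simp: vertex_cover_def)
  qed
  with A show "t \<notin> A \<and> vertex_cover C A"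
    by (auto simp: vertex_cover_def contraction_def)
next
  assume "t \<notin> A \<and> vertex_cover C A"
  then show "vertex_cover (contraction C t) A"
    by (fastforce simp: vertex_cover_def contraction_def minimal_sets_def)
qed

text \<open>
  Since a cover contains a minimal one, the monomials of all covers lie in the ideal of covers.
  Containments between ideals of covers can therefore be checked without deciding which
  covers stay minimal after an operation on the clutter.
\<close>

lemma squarefree_monom_cover:
  fixes C :: "'v set_system"
  assumes fin: "finite (verts C)" and A: "vertex_cover C A"
  shows "squarefree_monom A \<in> cover_ideal TYPE('k::field) C"
proof -
  have AV: "A \<subseteq> verts C" and "finite A"
    using assms finite_subset by (auto simp: vertex_cover_def)
  then obtain B where B: "B \<in> min_vertex_covers C" "B \<subseteq> A"
    using A minimal_sets_below[of A "{A. vertex_cover C A}"] by (auto simp: min_vertex_covers_def)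
  interpret cring "mpoly_ring TYPE('k) (verts C)" by (rule cring_mpoly_ring)
  interpret ideal "cover_ideal TYPE('k) C" "mpoly_ring TYPE('k) (verts C)"
    by (rule ideal_cover_ideal)
  have "squarefree_monom B \<in> cover_ideal TYPE('k) C"
    unfolding cover_ideal_def using B(1)
    by (intro subsetD[OF genideal_self] imageI)
      (auto simp: min_vertex_covers_def minimal_sets_def vertex_cover_def
        intro!: squarefree_monom_closed)
  moreover have "squarefree_monom (A - B) \<in> carrier (mpoly_ring TYPE('k) (verts C))"
    using AV by (intro squarefree_monom_closed) auto
  ultimately have "squarefree_monom (A - B) \<otimes>\<^bsub>mpoly_ring TYPE('k) (verts C)\<^esub> squarefree_monom B
      \<in> cover_ideal TYPE('k) C"
    by (intro I_l_closed)
  moreover have "squarefree_monom (A - B) * squarefree_monom B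
      = (squarefree_monom A :: ('v \<Rightarrow>\<^sub>0 nat) \<Rightarrow>\<^sub>0 'k)"
    unfolding squarefree_monom_def using \<open>finite A\<close> B(2) by (intro prod.subset_diff[symmetric])
  ultimately show ?thesis by (simp add: mpoly_ring_def)
qed

text \<open>
  The elements that \<open>x \<mapsto> u h(x)\<close> sends into \<open>I\<close> form an ideal, so it is enough to look at generators.
\<close>

lemma cover_ideal_semilinear:
  assumes h: "ring_hom_cring (mpoly_ring TYPE('k::field) (verts C)) S h"
    and u: "u \<in> carrier S" and I: "ideal I S"
    and gen: "\<And>A. vertex_cover C A \<Longrightarrow> u \<otimes>\<^bsub>S\<^esub> h (squarefree_monom A) \<in> I"
    and x: "x \<in> cover_ideal TYPE('k) C"
  shows "u \<otimes>\<^bsub>S\<^esub> h x \<in> I"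
proof -
  let ?R = "mpoly_ring TYPE('k) (verts C)"
  interpret h: ring_hom_cring ?R S h by (rule h)
  interpret I: ideal I S by (rule I)
  let ?L = "{x \<in> carrier ?R. u \<otimes>\<^bsub>S\<^esub> h x \<in> I}"
  have "ideal ?L ?R"
  proof (rule idealI)
    show "subgroup ?L (add_monoid ?R)"
    proof (rule h.R.add.subgroupI)
      show "?L \<noteq> {}"
        using u I.zero_closed by (auto intro!: exI[of _ "\<zero>\<^bsub>?R\<^esub>"])
    qed (use u in \<open>auto simp: h.S.r_distr h.S.r_minus simp flip: a_inv_def\<close>)
  next
    fix a b assume a: "a \<in> ?L" and b: "b \<in> carrier ?R"
    have "u \<otimes>\<^bsub>S\<^esub> h (b \<otimes>\<^bsub>?R\<^esub> a) = h b \<otimes>\<^bsub>S\<^esub> (u \<otimes>\<^bsub>S\<^esub> h a)"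
      using a b u by (simp add: h.S.m_ac)
    then show "b \<otimes>\<^bsub>?R\<^esub> a \<in> ?L" using a b by (simp add: I.I_l_closed)
    then show "a \<otimes>\<^bsub>?R\<^esub> b \<in> ?L" using a b by (simp add: h.R.m_comm)
  qed (rule h.R.ring_axioms)
  moreover have "squarefree_monom ` min_vertex_covers C \<subseteq> ?L"
    using gen
    by (auto simp: min_vertex_covers_def minimal_sets_def vertex_cover_def
        intro!: squarefree_monom_closed)
  ultimately have "cover_ideal TYPE('k) C \<subseteq> ?L"
    unfolding cover_ideal_def by (rule h.R.genideal_minimal)
  with x show ?thesis by blast
qed

lemma eval_var_squarefree_monom:
  fixes c :: "'k::field"
  assumes "finite A"
  shows "eval_var t c (squarefree_monom A) =
    (if t \<in> A then Poly_Mapping.single 0 c else 1) * squarefree_monom (A - {t})"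
proof -
  have *: "eval_var t c (squarefree_monom B) = squarefree_monom B" if "t \<notin> B" for B
    using squarefree_monom_closed[of B "- {t}", where 'k = 'k] that
    by (intro eval_var_eq_self) (auto simp: mpoly_ring_def)
  show ?thesis
  proof (cases "t \<in> A")
    case True
    have "(squarefree_monom A :: _ \<Rightarrow>\<^sub>0 'k)
        = Poly_Mapping.single (Poly_Mapping.single t 1) 1 * squarefree_monom (A - {t})"
      unfolding squarefree_monom_def by (rule prod.remove[OF assms True])
    moreover have "Poly_Mapping.update t 0 (Poly_Mapping.single t (1::nat)) = 0"
      by (rule poly_mapping_eqI) (simp add: lookup_update lookup_single)
    ultimately show ?thesis
      using True by (simp add: eval_var_mult eval_var_single *)
  qed (simp add: *)
qed

text \<open>
  Setting \<open>t\<close> to zero kills the monomials of covers through \<open>t\<close>, and keeps those of the other covers,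
  which are the covers of the contraction.
\<close>

lemma normal_cover_ideal_contraction:
  assumes C: "clutter C"
    and normal: "normal_ideal (mpoly_ring TYPE('k::field) (verts C)) (cover_ideal TYPE('k) C)"
  shows "normal_ideal (mpoly_ring TYPE('k) (verts (contraction C t)))
    (cover_ideal TYPE('k) (contraction C t))"
proof -
  let ?D = "contraction C t"
  let ?R = "mpoly_ring TYPE('k) (verts C)" and ?S = "mpoly_ring TYPE('k) (verts ?D)"
  have V: "verts ?D = verts C - {t}" by (simp add: contraction_def)
  have fin: "finite (verts C)" "finite (verts ?D)" using C by (auto simp: clutter_def V)
  have incl: "ring_hom_cring ?S ?R (\<lambda>p. p)" by (rule ring_hom_inclusion) (auto simp: V)
  have ev: "ring_hom_cring ?R ?S (eval_var t 0)" unfolding V by (rule ring_hom_eval_var)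
  interpret ev: ring_hom_cring ?R ?S "eval_var t 0" by (rule ev)
  interpret J: ideal "cover_ideal TYPE('k) ?D" ?S by (rule ideal_cover_ideal)
  show ?thesis
  proof (rule normal_ideal_retract[OF incl ev _ _ _ ideal_cover_ideal _ _ normal,
        where u = "\<one>\<^bsub>?R\<^esub>"])
    show "eval_var t 0 x = x" if "x \<in> carrier ?S" for x
      using that by (intro eval_var_eq_self) (auto simp: mpoly_ring_def V)
    show "\<one>\<^bsub>?R\<^esub> \<otimes>\<^bsub>?R\<^esub> x \<in> cover_ideal TYPE('k) C" if "x \<in> cover_ideal TYPE('k) ?D" for x
    proof (rule cover_ideal_semilinear[OF incl _ ideal_cover_ideal _ that])
      fix A assume "vertex_cover ?D A"
      then have A: "vertex_cover C A" by (simp add: vertex_cover_contraction[OF C])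
      then show "\<one>\<^bsub>?R\<^esub> \<otimes>\<^bsub>?R\<^esub> squarefree_monom A \<in> cover_ideal TYPE('k) C"
        using squarefree_monom_cover[OF fin(1) A, where 'k = 'k] by (simp add: mpoly_ring_def)
    qed simp
    show "eval_var t 0 x \<in> cover_ideal TYPE('k) ?D" if x: "x \<in> cover_ideal TYPE('k) C" for x
    proof -
      have "\<one>\<^bsub>?S\<^esub> \<otimes>\<^bsub>?S\<^esub> eval_var t 0 x \<in> cover_ideal TYPE('k) ?D"
      proof (rule cover_ideal_semilinear[OF ev _ ideal_cover_ideal _ x])
        fix A assume A: "vertex_cover C A"
        then have "finite A" using fin finite_subset by (auto simp: vertex_cover_def)
        have "eval_var t 0 (squarefree_monom A) \<in> cover_ideal TYPE('k) ?D"
        proof (cases "t \<in> A")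
          case True
          have "(0 :: ('a \<Rightarrow>\<^sub>0 nat) \<Rightarrow>\<^sub>0 'k) \<in> cover_ideal TYPE('k) ?D"
            using J.zero_closed by (simp add: mpoly_ring_def)
          then show ?thesis
            using True by (simp add: eval_var_squarefree_monom[OF \<open>finite A\<close>])
        next
          case False
          then have "vertex_cover ?D A" using A by (simp add: vertex_cover_contraction[OF C])
          from squarefree_monom_cover[OF fin(2) this] False show ?thesis
            by (simp add: eval_var_squarefree_monom[OF \<open>finite A\<close>])
        qed
        then show "\<one>\<^bsub>?S\<^esub> \<otimes>\<^bsub>?S\<^esub> eval_var t 0 (squarefree_monom A) \<in> cover_ideal TYPE('k) ?D"
          by (simp add: mpoly_ring_def)
      qed simp
      then show ?thesis by (simp add: mpoly_ring_def)
    qed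
  qed simp_all
qed

text \<open>
  Setting \<open>t\<close> to one removes \<open>t\<close> from the monomial of a cover, leaving a cover of the deletion;
  multiplication by \<open>t\<close> goes back. This is where the twist \<open>u = t\<close> is needed: a cover of the deletion
  may miss edges through \<open>t\<close>.
\<close>

lemma normal_cover_ideal_deletion:
  assumes C: "clutter C" and t: "t \<in> verts C"
    and normal: "normal_ideal (mpoly_ring TYPE('k::field) (verts C)) (cover_ideal TYPE('k) C)"
  shows "normal_ideal (mpoly_ring TYPE('k) (verts (deletion C t)))
    (cover_ideal TYPE('k) (deletion C t))"
proof -
  let ?D = "deletion C t"
  let ?R = "mpoly_ring TYPE('k) (verts C)" and ?S = "mpoly_ring TYPE('k) (verts ?D)"
  have V: "verts ?D = verts C - {t}" by (simp add: deletion_def)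
  have fin: "finite (verts C)" "finite (verts ?D)" using C by (auto simp: clutter_def V)
  have incl: "ring_hom_cring ?S ?R (\<lambda>p. p)" by (rule ring_hom_inclusion) (auto simp: V)
  have ev: "ring_hom_cring ?R ?S (eval_var t 1)" unfolding V by (rule ring_hom_eval_var)
  interpret ev: ring_hom_cring ?R ?S "eval_var t 1" by (rule ev)
  let ?t = "squarefree_monom {t} :: ('a \<Rightarrow>\<^sub>0 nat) \<Rightarrow>\<^sub>0 'k"
  have tR: "?t \<in> carrier ?R" using t by (intro squarefree_monom_closed) simp
  show ?thesis
  proof (rule normal_ideal_retract[OF incl ev _ tR _ ideal_cover_ideal _ _ normal])
    show "eval_var t 1 x = x" if "x \<in> carrier ?S" for x
      using that by (intro eval_var_eq_self) (auto simp: mpoly_ring_def V)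
    show "eval_var t 1 ?t = \<one>\<^bsub>?S\<^esub>"
      by (simp add: eval_var_squarefree_monom) (simp add: mpoly_ring_def squarefree_monom_def)
    show "?t \<otimes>\<^bsub>?R\<^esub> x \<in> cover_ideal TYPE('k) C" if "x \<in> cover_ideal TYPE('k) ?D" for x
    proof (rule cover_ideal_semilinear[OF incl tR ideal_cover_ideal _ that])
      fix A assume "vertex_cover ?D A"
      then have A: "t \<notin> A" "vertex_cover C (insert t A)"
        by (simp_all add: vertex_cover_deletion[OF t])
      then have "finite A" using fin finite_subset by (auto simp: vertex_cover_def)
      then have "?t * squarefree_monom A = squarefree_monom (insert t A)"
        using A(1) by (simp add: squarefree_monom_def)
      then show "?t \<otimes>\<^bsub>?R\<^esub> squarefree_monom A \<in> cover_ideal TYPE('k) C"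
        using squarefree_monom_cover[OF fin(1) A(2), where 'k = 'k] by (simp add: mpoly_ring_def)
    qed
    show "eval_var t 1 x \<in> cover_ideal TYPE('k) ?D" if x: "x \<in> cover_ideal TYPE('k) C" for x
    proof -
      have "\<one>\<^bsub>?S\<^esub> \<otimes>\<^bsub>?S\<^esub> eval_var t 1 x \<in> cover_ideal TYPE('k) ?D"
      proof (rule cover_ideal_semilinear[OF ev _ ideal_cover_ideal _ x])
        fix A assume A: "vertex_cover C A"
        then have "finite A" using fin finite_subset by (auto simp: vertex_cover_def)
        have "vertex_cover ?D (A - {t})"
          using A t by (auto simp: vertex_cover_deletion[OF t]) (auto simp: vertex_cover_def)
        from squarefree_monom_cover[OF fin(2) this, where 'k = 'k]
        have "eval_var t 1 (squarefree_monom A) \<in> cover_ideal TYPE('k) ?D"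
          by (cases "t \<in> A") (simp_all add: eval_var_squarefree_monom[OF \<open>finite A\<close>])
        then show "\<one>\<^bsub>?S\<^esub> \<otimes>\<^bsub>?S\<^esub> eval_var t 1 (squarefree_monom A) \<in> cover_ideal TYPE('k) ?D"
          by (simp add: mpoly_ring_def)
      qed simp
      then show ?thesis by (simp add: mpoly_ring_def)
    qed
  qed
qed

theorem proposition3p7:
  fixes C H :: "'v set_system"
  assumes "clutter C"
    and "normal_ideal (mpoly_ring TYPE('k::field) (verts C)) (cover_ideal TYPE('k) C)"
    and "minor H C"
  shows "normal_ideal (mpoly_ring TYPE('k) (verts H)) (cover_ideal TYPE('k) H)"
  using assms(3,1,2)
proof (induction rule: minor.induct)
  case (minor_deletion H C t)
  then show ?case
    by (intro normal_cover_ideal_deletion) (auto intro: clutter_minor)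
next
  case (minor_contraction H C t)
  then show ?case
    by (intro normal_cover_ideal_contraction) (auto intro: clutter_minor)
qed

end
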